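(* Let $\mathcal{I}$ and $\mathcal{J}$ be finite interpretations, $\Delta'\subseteq\Delta^{\mathcal{I}}$ and $\Delta''\subseteq\Delta^{\mathcal{J}}$, and suppose $\mathit{Names}(\Delta',\mathcal{I})\neq\emptyset$ and $\mathit{Names}(\Delta'',\mathcal{J})\neq\emptyset$. Let $Z$ be the maximal $\mathcal{ALC}$ bisimulation between $\mathcal{I}$ and $\mathcal{J}$. Then $\mathit{Names}(\Delta',\mathcal{I})=\mathit{Names}(\Delta'',\mathcal{J})$ if and only if $Z$ is total (left-total on $\Delta^{\mathcal{I}}$ and right-total on $\Delta^{\mathcal{J}}$) and the restriction $Z\cap(\mathit{NamedInd}(\Delta',\mathcal{I})\times\mathit{NamedInd}(\Delta'',\mathcal{J}))$ is total (left-total on $\mathit{NamedInd}(\Delta',\mathcal{I})$ and right-total on $\mathit{NamedInd}(\Delta'',\mathcal{J})$).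
   Context: $\mathcal{ALC}$ concepts: $C ::= A \mid \neg C \mid (C\sqcap C)\mid \exists r.C$ with the standard semantics over interpretations $\mathcal{I}=(\Delta^{\mathcal{I}},\cdot^{\mathcal{I}})$. An $\mathcal{ALC}$ bisimulation is a relation $Z\subseteq\Delta^{\mathcal{I}}\times\Delta^{\mathcal{J}}$ satisfying the standard Atom, Forth and Back conditions; the maximal one is the union of all of them. For $\Delta'\subseteq\Delta^{\mathcal{I}}$: $\mathit{Names}(\Delta',\mathcal{I})$ is the set of all $\mathcal{ALC}$ concepts $C$ with $C^{\mathcal{I}}=\{d\}$ for some $d\in\Delta'$; $\mathit{NamedInd}(\Delta',\mathcal{I})$ is the set of all $d\in\Delta'$ such that $d\in C^{\mathcal{I}}$ for some $C\in\mathit{Names}(\Delta',\mathcal{I})$. *)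

theory Defs
  imports Main
begin

text \<open>The type variables \<open>'c\<close> and \<open>'r\<close> are the sets of concept names and role names.\<close>

datatype ('c, 'r) concept =
    Name 'c
  | Neg "('c, 'r) concept"
  | And "('c, 'r) concept" "('c, 'r) concept"
  | Ex 'r "('c, 'r) concept"

record ('d, 'c, 'r) interp =
  domain :: "'d set"
  cname :: "'c \<Rightarrow> 'd set"
  rname :: "'r \<Rightarrow> ('d \<times> 'd) set"

definition interpretation_alc :: "('d, 'c, 'r) interp \<Rightarrow> bool" where
  "interpretation_alc I \<longleftrightarrow>
     domain I \<noteq> {} \<and> (\<forall>A. cname I A \<subseteq> domain I) \<and> (\<forall>r. rname I r \<subseteq> domain I \<times> domain I)"

definition finite_interpretation :: "('d, 'c, 'r) interp \<Rightarrow> bool" where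
  "finite_interpretation I \<longleftrightarrow> interpretation_alc I \<and> finite (domain I)"

primrec ext :: "('d, 'c, 'r) interp \<Rightarrow> ('c, 'r) concept \<Rightarrow> 'd set" where
  "ext I (Name A) = cname I A"
| "ext I (Neg C) = domain I - ext I C"
| "ext I (And C D) = ext I C \<inter> ext I D"
| "ext I (Ex r C) = {d \<in> domain I. \<exists>e. (d, e) \<in> rname I r \<and> e \<in> ext I C}"

definition bisimulation ::
    "('d, 'c, 'r) interp \<Rightarrow> ('e, 'c, 'r) interp \<Rightarrow> ('d \<times> 'e) set \<Rightarrow> bool" where
  "bisimulation I J Z \<longleftrightarrow>
     Z \<subseteq> domain I \<times> domain J \<and>
     (\<forall>d e A. (d, e) \<in> Z \<longrightarrow> (d \<in> cname I A \<longleftrightarrow> e \<in> cname J A)) \<and>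
     (\<forall>d e r d'. (d, e) \<in> Z \<and> (d, d') \<in> rname I r \<longrightarrow>
        (\<exists>e'. (e, e') \<in> rname J r \<and> (d', e') \<in> Z)) \<and>
     (\<forall>d e r e'. (d, e) \<in> Z \<and> (e, e') \<in> rname J r \<longrightarrow>
        (\<exists>d'. (d, d') \<in> rname I r \<and> (d', e') \<in> Z))"

definition max_bisimulation ::
    "('d, 'c, 'r) interp \<Rightarrow> ('e, 'c, 'r) interp \<Rightarrow> ('d \<times> 'e) set" where
  "max_bisimulation I J = \<Union> {Z. bisimulation I J Z}"

definition Names :: "'d set \<Rightarrow> ('d, 'c, 'r) interp \<Rightarrow> ('c, 'r) concept set" where
  "Names D I = {C. \<exists>d\<in>D. ext I C = {d}}"

definition NamedInd :: "'d set \<Rightarrow> ('d, 'c, 'r) interp \<Rightarrow> 'd set" where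
  "NamedInd D I = {d \<in> D. \<exists>C\<in>Names D I. d \<in> ext I C}"

definition left_total_on :: "'d set \<Rightarrow> ('d \<times> 'e) set \<Rightarrow> bool" where
  "left_total_on A R \<longleftrightarrow> (\<forall>a\<in>A. \<exists>b. (a, b) \<in> R)"

definition right_total_on :: "'e set \<Rightarrow> ('d \<times> 'e) set \<Rightarrow> bool" where
  "right_total_on B R \<longleftrightarrow> (\<forall>b\<in>B. \<exists>a. (a, b) \<in> R)"

end

theory Submission
  imports Defs
begin

text \<open>
  On finite interpretations the maximal bisimulation is concept equivalence (Hennessy--Milner), and
  an element of \<open>I\<close> without an equivalent partner in \<open>J\<close> satisfies a concept \<open>C\<close> that is
  empty in \<open>J\<close>. If \<open>N\<close> is a common name, then \<open>N \<squnion> C\<close> and \<open>N \<sqinter> \<not>C\<close> have in \<open>J\<close> the same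
  extension as \<open>N\<close>. Equal names would make both of them names in \<open>I\<close>, which is impossible for a
  satisfiable \<open>C\<close>. Conversely, if a name \<open>C\<close> of \<open>d\<close> held at two elements of \<open>J\<close>, then both would
  be equivalent to \<open>d\<close> and hence to each other, but one of them, the named partner of \<open>d\<close>, is
  singled out by a concept.
\<close>

lemma ext_subset_domain:
  assumes "interpretation_alc I"
  shows "ext I C \<subseteq> domain I"
  using assms by (induction C) (auto simp: interpretation_alc_def)

definition Or :: "('c, 'r) concept \<Rightarrow> ('c, 'r) concept \<Rightarrow> ('c, 'r) concept" where
  "Or C D = Neg (And (Neg C) (Neg D))"

lemma ext_Or:
  assumes "interpretation_alc I"
  shows "ext I (Or C D) = ext I C \<union> ext I D"
  using ext_subset_domain[OF assms] by (auto simp: Or_def)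

definition concept_equiv ::
    "('d, 'c, 'r) interp \<Rightarrow> ('e, 'c, 'r) interp \<Rightarrow> ('d \<times> 'e) set" where
  "concept_equiv I J =
     {(d, e) \<in> domain I \<times> domain J. \<forall>C. d \<in> ext I C \<longleftrightarrow> e \<in> ext J C}"

lemma concept_equiv_ext_iff:
  "(d, e) \<in> concept_equiv I J \<Longrightarrow> d \<in> ext I C \<longleftrightarrow> e \<in> ext J C"
  by (simp add: concept_equiv_def)

lemma converse_concept_equiv: "(concept_equiv I J)\<inverse> = concept_equiv J I"
  by (auto simp: concept_equiv_def)

lemma not_concept_equiv_separated:
  assumes "d \<in> domain I" and "e \<in> domain J" and "(d, e) \<notin> concept_equiv I J"
  obtains C where "d \<in> ext I C" and "e \<notin> ext J C"
proof -
  obtain C where "d \<in> ext I C \<longleftrightarrow> e \<notin> ext J C"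
    using assms by (auto simp: concept_equiv_def)
  then consider "d \<in> ext I C" "e \<notin> ext J C" | "d \<in> ext I (Neg C)" "e \<notin> ext J (Neg C)"
    using \<open>d \<in> domain I\<close> by auto
  then show thesis
    using that by cases
qed

lemma not_concept_equiv_separated_finite:
  assumes "finite S" and "S \<subseteq> domain J" and "d \<in> domain I"
    and "\<forall>e\<in>S. (d, e) \<notin> concept_equiv I J"
  shows "\<exists>C. d \<in> ext I C \<and> S \<inter> ext J C = {}"
  using assms(1,2,4)
proof (induction S rule: finite_induct)
  case empty
  have "d \<in> ext I (Neg (And C (Neg C)))" for C
    using \<open>d \<in> domain I\<close> by simp
  then show ?case
    by blast
next
  case (insert e S)
  then obtain C where "d \<in> ext I C" and "S \<inter> ext J C = {}"
    by auto
  moreover obtain F where "d \<in> ext I F" and "e \<notin> ext J F"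
    using insert.prems \<open>d \<in> domain I\<close> not_concept_equiv_separated[of d I e J] by auto
  ultimately have "d \<in> ext I (And F C) \<and> insert e S \<inter> ext J (And F C) = {}"
    by auto
  then show ?case
    by blast
qed

lemma bisimulation_ext_iff:
  assumes "bisimulation I J Z" and "(d, e) \<in> Z"
  shows "d \<in> ext I C \<longleftrightarrow> e \<in> ext J C"
  using assms(2)
proof (induction C arbitrary: d e)
  case (Name A)
  then show ?case
    using assms(1) by (auto simp: bisimulation_def)
next
  case (Neg C)
  then show ?case
    using assms(1) by (auto simp: bisimulation_def)
next
  case (And C D)
  then show ?case
    by auto
next
  case (Ex r C)
  have "d \<in> domain I" and "e \<in> domain J"
    using assms(1) Ex.prems by (auto simp: bisimulation_def)
  moreover have "\<exists>e'. (e, e') \<in> rname J r \<and> (d', e') \<in> Z" if "(d, d') \<in> rname I r" for d'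
    using assms(1) Ex.prems that unfolding bisimulation_def by blast
  moreover have "\<exists>d'. (d, d') \<in> rname I r \<and> (d', e') \<in> Z" if "(e, e') \<in> rname J r" for e'
    using assms(1) Ex.prems that unfolding bisimulation_def by blast
  ultimately show ?case
    unfolding ext.simps using Ex.IH by blast
qed

lemma bisimulation_subset_concept_equiv:
  assumes "bisimulation I J Z"
  shows "Z \<subseteq> concept_equiv I J"
proof -
  have "Z \<subseteq> domain I \<times> domain J"
    using assms by (simp add: bisimulation_def)
  then show ?thesis
    using bisimulation_ext_iff[OF assms] by (auto simp: concept_equiv_def)
qed

definition image_finite :: "('d, 'c, 'r) interp \<Rightarrow> bool" where
  "image_finite I \<longleftrightarrow> (\<forall>r d. finite (rname I r `` {d}))"

lemma finite_interpretation_imp_image_finite: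
  assumes "finite_interpretation I"
  shows "image_finite I"
proof -
  have "rname I r `` {d} \<subseteq> domain I" for r d
    using assms by (auto simp: finite_interpretation_def interpretation_alc_def)
  then show ?thesis
    using assms by (auto simp: image_finite_def finite_interpretation_def intro: finite_subset)
qed

lemma concept_equiv_forth:
  assumes "interpretation_alc I" and "interpretation_alc J" and "image_finite J"
    and "(d, e) \<in> concept_equiv I J" and "(d, d') \<in> rname I r"
  shows "\<exists>e'. (e, e') \<in> rname J r \<and> (d', e') \<in> concept_equiv I J"
proof (rule ccontr)
  assume no_partner: "\<not> ?thesis"
  have "d \<in> domain I" and "d' \<in> domain I" and "rname J r `` {e} \<subseteq> domain J"
    using assms(1,2,5) by (auto simp: interpretation_alc_def)
  moreover have "finite (rname J r `` {e})"
    using \<open>image_finite J\<close> by (simp add: image_finite_def)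
  moreover have "\<forall>e'\<in>rname J r `` {e}. (d', e') \<notin> concept_equiv I J"
    using no_partner by auto
  ultimately obtain C where "d' \<in> ext I C" and "rname J r `` {e} \<inter> ext J C = {}"
    using not_concept_equiv_separated_finite[of "rname J r `` {e}" J d' I] by auto
  then have "d \<in> ext I (Ex r C)" and "e \<notin> ext J (Ex r C)"
    using \<open>d \<in> domain I\<close> assms(5) by auto
  then show False
    using concept_equiv_ext_iff[OF assms(4)] by blast
qed

lemma bisimulation_concept_equiv:
  assumes "interpretation_alc I" and "interpretation_alc J"
    and "image_finite I" and "image_finite J"
  shows "bisimulation I J (concept_equiv I J)"
  unfolding bisimulation_def
proof (intro conjI allI impI; (elim conjE)?)
  show "concept_equiv I J \<subseteq> domain I \<times> domain J"
    by (auto simp: concept_equiv_def)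
next
  fix d e A
  assume "(d, e) \<in> concept_equiv I J"
  then show "d \<in> cname I A \<longleftrightarrow> e \<in> cname J A"
    using concept_equiv_ext_iff[of d e I J "Name A"] by simp
next
  fix d e r d'
  assume "(d, e) \<in> concept_equiv I J" and "(d, d') \<in> rname I r"
  then show "\<exists>e'. (e, e') \<in> rname J r \<and> (d', e') \<in> concept_equiv I J"
    by (rule concept_equiv_forth[OF assms(1,2,4)])
next
  fix d e r e'
  assume "(d, e) \<in> concept_equiv I J" and "(e, e') \<in> rname J r"
  then show "\<exists>d'. (d, d') \<in> rname I r \<and> (d', e') \<in> concept_equiv I J"
    using concept_equiv_forth[OF assms(2,1,3), of e d e' r]
    by (simp flip: converse_concept_equiv[of I J])
qed

theorem max_bisimulation_eq_concept_equiv: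
  assumes "interpretation_alc I" and "interpretation_alc J"
    and "image_finite I" and "image_finite J"
  shows "max_bisimulation I J = concept_equiv I J"
  using bisimulation_concept_equiv[OF assms] bisimulation_subset_concept_equiv
  by (fastforce simp: max_bisimulation_def)

lemma ext_empty_if_Names_subset:
  assumes "interpretation_alc I" and "interpretation_alc J"
    and "Names E J \<subseteq> Names D I" and "Names E J \<noteq> {}" and "ext J C = {}"
  shows "ext I C = {}"
proof -
  obtain N b where N: "b \<in> E" "ext J N = {b}" "N \<in> Names E J"
    using \<open>Names E J \<noteq> {}\<close> by (auto simp: Names_def)
  then have "b \<in> domain J"
    using ext_subset_domain[OF assms(2), of N] by simp
  then have "ext J (And N (Neg C)) = {b}" and "ext J (Or N C) = {b}"
    using N(2) \<open>ext J C = {}\<close> by (simp_all add: ext_Or[OF assms(2)])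
  then have "And N (Neg C) \<in> Names E J" and "Or N C \<in> Names E J"
    using \<open>b \<in> E\<close> by (simp_all add: Names_def del: ext.simps)
  then have "{N, And N (Neg C), Or N C} \<subseteq> Names D I"
    using N(3) assms(3) by blast
  then obtain a x y where a: "ext I N = {a}"
    and x: "ext I (And N (Neg C)) = {x}" and y: "ext I (Or N C) = {y}"
    by (auto simp only: Names_def insert_subset mem_Collect_eq)
  from a x have "a \<notin> ext I C"
    by auto
  moreover from a y have "ext I C \<subseteq> {a}"
    by (auto simp: ext_Or[OF assms(1)])
  ultimately show ?thesis
    by blast
qed

lemma left_total_on_concept_equiv_if_Names_subset:
  assumes "interpretation_alc I" and "finite_interpretation J"
    and "Names E J \<subseteq> Names D I" and "Names E J \<noteq> {}"
  shows "left_total_on (domain I) (concept_equiv I J)"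
  unfolding left_total_on_def
proof (rule ballI, rule ccontr)
  have interp: "interpretation_alc J" and fin: "finite (domain J)"
    using assms(2) by (simp_all add: finite_interpretation_def)
  fix d
  assume d: "d \<in> domain I" and "\<nexists>e. (d, e) \<in> concept_equiv I J"
  then have "\<forall>e\<in>domain J. (d, e) \<notin> concept_equiv I J"
    by blast
  with not_concept_equiv_separated_finite[OF fin subset_refl d]
  obtain C where "d \<in> ext I C" and "domain J \<inter> ext J C = {}"
    by auto
  moreover from this have "ext J C = {}"
    using ext_subset_domain[OF interp] by blast
  ultimately show False
    using ext_empty_if_Names_subset[OF assms(1) interp assms(3,4)] by blast
qed

lemma NamedInd_iff: "d \<in> NamedInd D I \<longleftrightarrow> d \<in> D \<and> (\<exists>C. ext I C = {d})"
proof
  assume "d \<in> NamedInd D I"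
  then obtain C where "d \<in> D" and "ext I C = {d}"
    by (auto simp: NamedInd_def Names_def)
  then show "d \<in> D \<and> (\<exists>C. ext I C = {d})"
    by (intro conjI exI)
qed (auto simp: NamedInd_def Names_def)

lemma left_total_on_NamedInd_concept_equiv:
  assumes "interpretation_alc I" and "left_total_on (domain I) (concept_equiv I J)"
    and "Names D I \<subseteq> Names E J"
  shows "left_total_on (NamedInd D I) (concept_equiv I J \<inter> (NamedInd D I \<times> NamedInd E J))"
  unfolding left_total_on_def
proof
  fix d
  assume d: "d \<in> NamedInd D I"
  then obtain C where "d \<in> D" and C: "ext I C = {d}"
    by (auto simp: NamedInd_iff)
  then have "C \<in> Names E J"
    using assms(3) by (auto simp: Names_def)
  then obtain e where "e \<in> E" and e: "ext J C = {e}"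
    by (auto simp: Names_def)
  have "d \<in> domain I"
    using ext_subset_domain[OF assms(1), of C] C by simp
  then obtain e' where "(d, e') \<in> concept_equiv I J"
    using assms(2) by (auto simp: left_total_on_def)
  moreover from this have "e' = e"
    using concept_equiv_ext_iff[of d e' I J C] C e by simp
  moreover have "e \<in> NamedInd E J"
    using \<open>e \<in> E\<close> e by (auto simp only: NamedInd_iff)
  ultimately show "\<exists>e. (d, e) \<in> concept_equiv I J \<inter> (NamedInd D I \<times> NamedInd E J)"
    using d by blast
qed

lemma Names_subset_if_concept_equiv_total:
  assumes "interpretation_alc J" and "right_total_on (domain J) (concept_equiv I J)"
    and "left_total_on (NamedInd D I) (concept_equiv I J \<inter> (NamedInd D I \<times> NamedInd E J))"
  shows "Names D I \<subseteq> Names E J"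
proof
  fix C
  assume "C \<in> Names D I"
  then obtain d where "d \<in> D" and d: "ext I C = {d}"
    by (auto simp: Names_def)
  then have "d \<in> NamedInd D I"
    by (auto simp: NamedInd_iff)
  then obtain e where de: "(d, e) \<in> concept_equiv I J" and "e \<in> NamedInd E J"
    using assms(3) by (auto simp: left_total_on_def)
  then obtain N where "e \<in> E" and N: "ext J N = {e}"
    by (auto simp: NamedInd_iff)
  have "e' = e" if e': "e' \<in> ext J C" for e'
  proof -
    have "e' \<in> domain J"
      using e' ext_subset_domain[OF assms(1)] by blast
    then obtain d' where d'e': "(d', e') \<in> concept_equiv I J"
      using assms(2) by (auto simp: right_total_on_def)
    then have "d' = d"
      using concept_equiv_ext_iff[OF d'e', of C] e' d by simp
    then show ?thesis
      using concept_equiv_ext_iff[OF d'e', of N] concept_equiv_ext_iff[OF de, of N] N by simp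
  qed
  moreover have "e \<in> ext J C"
    using concept_equiv_ext_iff[OF de, of C] d by simp
  ultimately have "ext J C = {e}"
    by blast
  then show "C \<in> Names E J"
    using \<open>e \<in> E\<close> by (auto simp: Names_def)
qed

lemma right_total_on_iff_left_total_on_converse:
  "right_total_on B R \<longleftrightarrow> left_total_on B (R\<inverse>)"
  by (simp add: left_total_on_def right_total_on_def)

theorem theorem4:
  fixes I :: "('d, 'c, 'r) interp" and J :: "('e, 'c, 'r) interp"
    and D' :: "'d set" and D'' :: "'e set" and Z :: "('d \<times> 'e) set"
  assumes "finite_interpretation I" and "finite_interpretation J"
    and "D' \<subseteq> domain I" and "D'' \<subseteq> domain J"
    and "Names D' I \<noteq> {}" and "Names D'' J \<noteq> {}"
    and "Z = max_bisimulation I J"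
  shows "Names D' I = Names D'' J \<longleftrightarrow>
    (left_total_on (domain I) Z \<and> right_total_on (domain J) Z \<and>
     left_total_on (NamedInd D' I) (Z \<inter> (NamedInd D' I \<times> NamedInd D'' J)) \<and>
     right_total_on (NamedInd D'' J) (Z \<inter> (NamedInd D' I \<times> NamedInd D'' J)))"
    (is "_ \<longleftrightarrow> ?total")
proof -
  have interp: "interpretation_alc I" "interpretation_alc J"
    using assms(1,2) by (simp_all add: finite_interpretation_def)
  have Z: "Z = concept_equiv I J"
    using max_bisimulation_eq_concept_equiv[OF interp] assms(1,2,7)
    by (simp add: finite_interpretation_imp_image_finite)
  note converse = right_total_on_iff_left_total_on_converse converse_Int converse_Times
    converse_concept_equiv
  show ?thesis
  proof
    assume names: "Names D' I = Names D'' J"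
    have "left_total_on (domain I) (concept_equiv I J)"
      and "left_total_on (domain J) (concept_equiv J I)"
      using left_total_on_concept_equiv_if_Names_subset interp assms(1,2,5,6) names by blast+
    then show ?total
      unfolding Z converse using interp names by (simp add: left_total_on_NamedInd_concept_equiv)
  next
    assume ?total
    then have "Names D' I \<subseteq> Names D'' J" and "Names D'' J \<subseteq> Names D' I"
      unfolding Z using interp by (simp_all add: Names_subset_if_concept_equiv_total converse)
    then show "Names D' I = Names D'' J"
      by (rule subset_antisym)
  qed
qed

end
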